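(* Let $V$ be a countable set with at least two elements. Let $(K_t)_{t\ge1}$ be a sequence of aperiodic and irreducible Markov transition operators on $V$ and $(\pi_t)_{t\ge1}$ a sequence of positive measures such that $\{(K_t,\pi_t)\}_{t\ge1}$ is a finite non-decreasing environment. Let $\alpha_t=\alpha(K_t^*K_t,\tilde\pi_t)$ be the logarithmic Sobolev constant of $K_t^*K_t$, where $K_t^*$ is the adjoint of $K_t$ on $\ell^2(\tilde\pi_t)$. For $q\ge2$ and $t\ge1$ define $$q_t=q\prod_{s=1}^t(1+\alpha_s).$$ Then for all $q\ge2$ and all $t\ge1$, $$\forall p\in[1,q_t],\ \forall f\in\ell^q(\pi_t),\quad \left\|K_{0,t}f\right\|_{\ell^p(\tilde\pi_1)}\le\left\|f\right\|_{\ell^q(\tilde\pi_t)}\left(\frac{\pi_t(V)}{\pi_1(V)}\right)^{1/q}.$$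
   Context: A Markov transition operator $K$ on $V$ is a map $K:V\times V\to[0,1]$ with $\sum_y K(x,y)=1$ for all $x$; it acts on functions by $(Kf)(x)=\sum_y K(x,y)f(y)$ and on measures by $(\mu K)(y)=\sum_x\mu(x)K(x,y)$. $K_{0,t}=K_1\cdots K_t$. Finite non-decreasing environment: the $\pi_t$ are positive measures ($\pi_t(x)>0$ for all $x$) with, for all $t\ge1$: $\pi_tK_t=\pi_t$; $\pi_t(V)<+\infty$; $\pi_{t+1}(x)\ge\pi_t(x)$ for all $x\in V$. For a finite measure $\pi$, $\tilde\pi:=\pi/\pi(V)$; $\|f\|_{\ell^p(\tilde\pi)}=(\sum_x|f(x)|^p\tilde\pi(x))^{1/p}$. Dirichlet form: $\mathcal E_{Q,\tilde\pi}(f,f)=\langle(I-Q)f,f\rangle_{\tilde\pi}=\frac12\sum_{x,y}(f(x)-f(y))^2\tilde\pi(x)Q(x,y)$. Entropy of a non-negative $f\in\ell^1(\tilde\pi)$: $\mathcal L(f\mid\tilde\pi)=\sum_xf(x)\log\left(\frac{f(x)}{\tilde\pi(f)}\right)\tilde\pi(x)\in[0,+\infty]$ (with $0\log0=0$). The logarithmic Sobolev constant $\alpha(Q)=\alpha(Q,\tilde\pi)\ge0$ is the largest $\alpha\ge 0$ with $\alpha\,\mathcal L(f^2\mid\tilde\pi)\le\mathcal E_{Q,\tilde\pi}(f,f)$ for all non-constant non-negative $f\in\ell^2(\tilde\pi)$ (with $0\cdot\infty=0$). *)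

theory Defs
  imports "HOL-Analysis.Analysis"
begin

definition markov_kernel :: "('v \<Rightarrow> 'v \<Rightarrow> real) \<Rightarrow> bool" where
  "markov_kernel K \<longleftrightarrow> (\<forall>x y. 0 \<le> K x y \<and> K x y \<le> 1) \<and> (\<forall>x. (K x has_sum 1) UNIV)"

definition kernel_act :: "('v \<Rightarrow> 'v \<Rightarrow> real) \<Rightarrow> ('v \<Rightarrow> real) \<Rightarrow> ('v \<Rightarrow> real)" where
  "kernel_act K f = (\<lambda>x. \<Sum>\<^sub>\<infinity>y. K x y * f y)"

fun kernel_power :: "('v \<Rightarrow> 'v \<Rightarrow> real) \<Rightarrow> nat \<Rightarrow> 'v \<Rightarrow> 'v \<Rightarrow> real" where
  "kernel_power K 0 x y = (if x = y then 1 else 0)"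
| "kernel_power K (Suc n) x y = (\<Sum>\<^sub>\<infinity>z. K x z * kernel_power K n z y)"

definition irreducible_kernel :: "('v \<Rightarrow> 'v \<Rightarrow> real) \<Rightarrow> bool" where
  "irreducible_kernel K \<longleftrightarrow> (\<forall>x y. \<exists>n. kernel_power K n x y > 0)"

definition aperiodic_kernel :: "('v \<Rightarrow> 'v \<Rightarrow> real) \<Rightarrow> bool" where
  "aperiodic_kernel K \<longleftrightarrow> (\<forall>x. Gcd {n. n \<ge> 1 \<and> kernel_power K n x x > 0} = 1)"

text \<open>The composite $K_{0,t} = K_1 \cdots K_t$ acting on functions; the index 0 of the
  sequence is never used.\<close>

fun kernel_prod_act :: "(nat \<Rightarrow> 'v \<Rightarrow> 'v \<Rightarrow> real) \<Rightarrow> nat \<Rightarrow> ('v \<Rightarrow> real) \<Rightarrow> ('v \<Rightarrow> real)" where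
  "kernel_prod_act K 0 f = f"
| "kernel_prod_act K (Suc t) f = kernel_prod_act K t (kernel_act (K (Suc t)) f)"

text \<open>Measures are given by their point masses. Since all measures considered are finite,
  real-valued masses suffice, and finiteness of the total mass is summability.\<close>

definition mass :: "('v \<Rightarrow> real) \<Rightarrow> real" where
  "mass \<pi> = (\<Sum>\<^sub>\<infinity>x. \<pi> x)"

definition normalized :: "('v \<Rightarrow> real) \<Rightarrow> ('v \<Rightarrow> real)" where
  "normalized \<pi> = (\<lambda>x. \<pi> x / mass \<pi>)"

definition finite_nondecreasing_environment ::
    "(nat \<Rightarrow> 'v \<Rightarrow> 'v \<Rightarrow> real) \<Rightarrow> (nat \<Rightarrow> 'v \<Rightarrow> real) \<Rightarrow> bool" where
  "finite_nondecreasing_environment K \<pi> \<longleftrightarrow> (\<forall>t\<ge>1.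
     (\<forall>x. \<pi> t x > 0) \<and>
     (\<forall>y. ((\<lambda>x. \<pi> t x * K t x y) has_sum \<pi> t y) UNIV) \<and>
     \<pi> t summable_on UNIV \<and>
     (\<forall>x. \<pi> (Suc t) x \<ge> \<pi> t x))"

definition lp_space :: "real \<Rightarrow> ('v \<Rightarrow> real) \<Rightarrow> ('v \<Rightarrow> real) set" where
  "lp_space p \<mu> = {f. (\<lambda>x. \<bar>f x\<bar> powr p * \<mu> x) summable_on UNIV}"

definition lp_norm :: "real \<Rightarrow> ('v \<Rightarrow> real) \<Rightarrow> ('v \<Rightarrow> real) \<Rightarrow> real" where
  "lp_norm p \<mu> f = (\<Sum>\<^sub>\<infinity>x. \<bar>f x\<bar> powr p * \<mu> x) powr (1 / p)"

definition l2_inner :: "('v \<Rightarrow> real) \<Rightarrow> ('v \<Rightarrow> real) \<Rightarrow> ('v \<Rightarrow> real) \<Rightarrow> real" where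
  "l2_inner \<mu> f g = (\<Sum>\<^sub>\<infinity>x. f x * g x * \<mu> x)"

text \<open>The Hilbert space adjoint on $\ell^2(\mu)$; the representing \<open>h\<close> is unique because
  \<open>\<mu>\<close> charges every point.\<close>

definition l2_adjoint ::
    "('v \<Rightarrow> real) \<Rightarrow> (('v \<Rightarrow> real) \<Rightarrow> ('v \<Rightarrow> real)) \<Rightarrow> (('v \<Rightarrow> real) \<Rightarrow> ('v \<Rightarrow> real))" where
  "l2_adjoint \<mu> T g = (THE h. h \<in> lp_space 2 \<mu> \<and>
      (\<forall>f \<in> lp_space 2 \<mu>. l2_inner \<mu> (T f) g = l2_inner \<mu> f h))"

definition dirichlet_form ::
    "(('v \<Rightarrow> real) \<Rightarrow> ('v \<Rightarrow> real)) \<Rightarrow> ('v \<Rightarrow> real) \<Rightarrow> ('v \<Rightarrow> real) \<Rightarrow> real" where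
  "dirichlet_form Q \<mu> f = l2_inner \<mu> (\<lambda>x. f x - Q f x) f"

text \<open>Entropy of a non-negative \<open>f\<close> in $\ell^1(\mu)$, \<open>\<mu>\<close> a probability. As
  $u \log u \ge -1/e$, the negative part of the series is always summable, so a series
  that is not summable diverges to \<open>\<infinity>\<close>. The convention $0 \log 0 = 0$ is
  automatic.\<close>

definition entropy_of :: "('v \<Rightarrow> real) \<Rightarrow> ('v \<Rightarrow> real) \<Rightarrow> ereal" where
  "entropy_of \<mu> f =
    (let g = (\<lambda>x. f x * ln (f x / (\<Sum>\<^sub>\<infinity>y. f y * \<mu> y)) * \<mu> x)
     in if g summable_on UNIV then ereal (\<Sum>\<^sub>\<infinity>x. g x) else \<infinity>)"

text \<open>Multiplication on \<^typ>\<open>ereal\<close> satisfies $0 \cdot \infty = 0$.\<close>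

definition log_sobolev_const ::
    "(('v \<Rightarrow> real) \<Rightarrow> ('v \<Rightarrow> real)) \<Rightarrow> ('v \<Rightarrow> real) \<Rightarrow> real" where
  "log_sobolev_const Q \<mu> = (GREATEST a. a \<ge> 0 \<and>
     (\<forall>f \<in> lp_space 2 \<mu>. (\<forall>x. f x \<ge> 0) \<and> \<not> (\<exists>c. \<forall>x. f x = c) \<longrightarrow>
        ereal a * entropy_of \<mu> (\<lambda>x. (f x)\<^sup>2) \<le> ereal (dirichlet_form Q \<mu> f)))"

end

theory Submission
  imports Defs
begin

text \<open>
  One step is Miclo's hypercontractivity bound $\|K f\|_{q(1+\alpha)} \le \|f\|_q$ for a kernel \<open>K\<close>
  with stationary probability \<open>\<mu>\<close>. For finitely supported $f \ge 0$ put $p = q(1+\alpha)$ and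
  $g = f^{p/2}$. Jensen gives $(Kf)^p \le (Kg)^2$. The Dirichlet form of $K^*K$ at \<open>g\<close> is
  $\|g\|_2^2 - \|Kg\|_2^2$, so the logarithmic Sobolev inequality bounds $\|Kg\|_2^2$ by
  $\|g\|_2^2 - \alpha \mathcal{L}(g^2)$, and convexity of $s \mapsto \log \|g\|_{2/(1+s)}^2$ bounds this
  by $\|g\|_{2/(1+\alpha)}^2 = \|f\|_q^p$. Exhausting \<open>V\<close> by finite sets removes the
  restriction on \<open>f\<close>. Iterating, each passage from $\pi_{t+1}$ to the smaller $\pi_t$ costs only the
  ratio of total masses, raised to a power at most $1/q$.
\<close>

section \<open>Jensen's inequality and the ordering of \<open>l^p\<close> norms\<close>

text \<open>Young's inequality with exponents \<open>r\<close> and \<open>r / (r - 1)\<close>,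
  applied to \<open>z = y / m\<close> and 1, is the tangent bound at 1; multiplying by
  \<open>m powr r\<close> moves the point of tangency to \<open>m\<close>. The case
  \<open>r = 1\<close> is split off because it has no finite conjugate exponent.\<close>

lemma powr_ge_tangent:
  fixes y m r :: real
  assumes "1 \<le> r" "0 \<le> y" "0 < m"
  shows "m powr r + r * m powr (r - 1) * (y - m) \<le> y powr r"
proof (cases "r = 1")
  case True
  then show ?thesis using assms by simp
next
  case False
  define z where "z = y / m"
  have z: "0 \<le> z" "y = m * z" using assms by (auto simp: z_def)
  have "z * 1 \<le> z powr r / r + 1 powr (r / (r - 1)) / (r / (r - 1))"
    by (rule Youngs_inequality) (use assms False z in \<open>auto simp: field_simps\<close>)
  then have "r * z \<le> r * (z powr r / r + (r - 1) / r)"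
    using assms by (intro mult_left_mono) auto
  also have "\<dots> = z powr r + (r - 1)"
    using assms by (simp add: field_simps)
  finally have "1 + r * (z - 1) \<le> z powr r"
    by (simp add: algebra_simps)
  then have "m powr r * (1 + r * (z - 1)) \<le> m powr r * z powr r"
    by (intro mult_left_mono) auto
  moreover have "m powr r = m powr (r - 1) * m"
    using assms powr_add[of m "r - 1" 1] by simp
  ultimately show ?thesis
    using assms z by (simp add: powr_mult algebra_simps)
qed

text \<open>The pointwise bound \<open>|f| \<le> 1 + |f|^r\<close> and the finite mass of
  \<open>w\<close> give a summable majorant.\<close>

lemma summable_on_weight_le_powr:
  fixes w f :: "'v \<Rightarrow> real"
  assumes "\<And>x. 0 \<le> w x" "w summable_on UNIV" "1 \<le> r"
    and "(\<lambda>x. w x * \<bar>f x\<bar> powr r) summable_on UNIV"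
  shows "(\<lambda>x. w x * \<bar>f x\<bar>) summable_on UNIV" "(\<lambda>x. w x * f x) summable_on UNIV"
proof -
  have le: "\<bar>f x\<bar> \<le> 1 + \<bar>f x\<bar> powr r" for x
  proof (cases "\<bar>f x\<bar> \<le> 1")
    case False
    then have "\<bar>f x\<bar> powr 1 \<le> \<bar>f x\<bar> powr r" using assms by (intro powr_mono) auto
    then show ?thesis using False by simp
  qed (auto intro: add_increasing2)
  have "(\<lambda>x. w x + w x * \<bar>f x\<bar> powr r) summable_on UNIV"
    using assms by (intro summable_on_add) auto
  then show 1: "(\<lambda>x. w x * \<bar>f x\<bar>) summable_on UNIV"
  proof (rule summable_on_comparison_test)
    show "w x * \<bar>f x\<bar> \<le> w x + w x * \<bar>f x\<bar> powr r" for x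
      using mult_left_mono[OF le assms(1), of x x] by (simp add: algebra_simps)
  qed (use assms in auto)
  show "(\<lambda>x. w x * f x) summable_on UNIV"
    unfolding summable_on_iff_abs_summable_on_real[of "\<lambda>x. w x * f x"]
    using 1 assms(1) by (simp add: abs_mult)
qed

text \<open>The tangent of the \<open>r\<close>-th power at the mean \<open>m\<close> of
  \<open>|f|\<close> is summed against \<open>w\<close>. Since \<open>w\<close> has mass 1, the
  linear term cancels and \<open>m powr r\<close> remains; the triangle inequality then replaces
  \<open>m\<close> by the modulus of the mean of \<open>f\<close>.\<close>

lemma jensen_powr_infsum:
  fixes w f :: "'v \<Rightarrow> real"
  assumes "\<And>x. 0 \<le> w x" "(w has_sum 1) UNIV" "1 \<le> r"
    and "(\<lambda>x. w x * \<bar>f x\<bar> powr r) summable_on UNIV"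
  shows "\<bar>\<Sum>\<^sub>\<infinity>x. w x * f x\<bar> powr r \<le> (\<Sum>\<^sub>\<infinity>x. w x * \<bar>f x\<bar> powr r)"
proof -
  have ws: "w summable_on UNIV" using assms(2) by (auto simp: summable_on_def)
  note s = summable_on_weight_le_powr[OF assms(1) ws assms(3,4)]
  define m where "m = (\<Sum>\<^sub>\<infinity>x. w x * \<bar>f x\<bar>)"
  have "norm (\<Sum>\<^sub>\<infinity>x. w x * f x) \<le> (\<Sum>\<^sub>\<infinity>x. norm (w x * f x))"
    by (rule norm_infsum_bound) (use s assms(1) in \<open>simp add: abs_mult\<close>)
  then have le: "\<bar>\<Sum>\<^sub>\<infinity>x. w x * f x\<bar> \<le> m"
    using assms(1) by (simp add: m_def abs_mult)
  have "m powr r \<le> (\<Sum>\<^sub>\<infinity>x. w x * \<bar>f x\<bar> powr r)"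
  proof (cases "m > 0")
    case True
    define c where "c = r * m powr (r - 1)"
    have 1: "((\<lambda>x. w x * (m powr r - c * m)) has_sum (1 * (m powr r - c * m))) UNIV"
      by (rule has_sum_cmult_left[OF assms(2)])
    have 2: "((\<lambda>x. c * (w x * \<bar>f x\<bar>)) has_sum (c * m)) UNIV"
      unfolding m_def by (intro has_sum_cmult_right has_sum_infsum s)
    from has_sum_add[OF 1 2]
    have "((\<lambda>x. w x * (m powr r + c * (\<bar>f x\<bar> - m))) has_sum (m powr r)) UNIV"
      by (simp add: algebra_simps)
    then show ?thesis
    proof (rule has_sum_mono[OF _ has_sum_infsum[OF assms(4)]])
      show "w x * (m powr r + c * (\<bar>f x\<bar> - m)) \<le> w x * \<bar>f x\<bar> powr r" for x
        unfolding c_def using assms True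
        by (intro mult_left_mono powr_ge_tangent) auto
    qed
  next
    case False
    moreover have "0 \<le> m" unfolding m_def using assms by (intro infsum_nonneg) auto
    ultimately show ?thesis using assms by (auto intro!: infsum_nonneg)
  qed
  moreover have "\<bar>\<Sum>\<^sub>\<infinity>x. w x * f x\<bar> powr r \<le> m powr r"
    using le assms by (intro powr_mono2) auto
  ultimately show ?thesis by linarith
qed

text \<open>Jensen's inequality with exponent \<open>r / p\<close>, applied to
  \<open>|f|^p\<close>.\<close>

lemma lp_space_lp_norm_mono:
  fixes \<mu> f :: "'v \<Rightarrow> real"
  assumes "\<And>x. 0 \<le> \<mu> x" "(\<mu> has_sum 1) UNIV" "1 \<le> p" "p \<le> r" "f \<in> lp_space r \<mu>"
  shows "f \<in> lp_space p \<mu>" "lp_norm p \<mu> f \<le> lp_norm r \<mu> f"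
proof -
  have ws: "\<mu> summable_on UNIV" using assms(2) by (auto simp: summable_on_def)
  define g where "g x = \<bar>f x\<bar> powr p" for x
  have g: "\<bar>g x\<bar> powr (r / p) = \<bar>f x\<bar> powr r" "\<bar>g x\<bar> = g x" for x
    using assms by (auto simp: g_def powr_powr)
  have r: "1 \<le> r / p" using assms by simp
  have s: "(\<lambda>x. \<mu> x * \<bar>g x\<bar> powr (r / p)) summable_on UNIV"
    using assms(5) unfolding g(1) by (simp add: lp_space_def mult.commute)
  from summable_on_weight_le_powr(2)[OF assms(1) ws r s]
  show "f \<in> lp_space p \<mu>" by (simp add: lp_space_def g_def mult.commute)
  define S T where "S = (\<Sum>\<^sub>\<infinity>x. \<mu> x * g x)" and "T = (\<Sum>\<^sub>\<infinity>x. \<mu> x * \<bar>f x\<bar> powr r)"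
  have S0: "0 \<le> S" unfolding S_def using assms by (intro infsum_nonneg) (auto simp: g_def)
  have "\<bar>S\<bar> powr (r / p) \<le> T"
    using jensen_powr_infsum[OF assms(1,2) r s] unfolding g(1) S_def T_def .
  then have "(S powr (r / p)) powr (1 / r) \<le> T powr (1 / r)"
    using S0 assms by (intro powr_mono2) auto
  then have "S powr (1 / p) \<le> T powr (1 / r)"
    using assms by (simp add: powr_powr)
  then show "lp_norm p \<mu> f \<le> lp_norm r \<mu> f"
    by (simp add: lp_norm_def S_def T_def g_def mult.commute)
qed

section \<open>A Markov kernel with a stationary probability, and its time reversal\<close>

text \<open>A single time step, detached from the sequence so that it can be instantiated with each
  \<open>K t\<close> and also with the time reversal of a kernel.\<close>

locale stationary_kernel =
  fixes K :: "'v \<Rightarrow> 'v \<Rightarrow> real" and \<mu> :: "'v \<Rightarrow> real"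
  assumes markov: "markov_kernel K"
    and pos: "\<And>x. 0 < \<mu> x"
    and prob: "(\<mu> has_sum 1) UNIV"
    and stationary: "\<And>y. ((\<lambda>x. \<mu> x * K x y) has_sum \<mu> y) UNIV"
begin

lemma K_nonneg: "0 \<le> K x y" and K_sum: "(K x has_sum 1) UNIV"
  using markov by (auto simp: markov_kernel_def)

lemma K_summable: "K x summable_on UNIV"
  using K_sum summable_on_def by blast

lemma \<mu>_nonneg: "0 \<le> \<mu> x"
  using pos[of x] by simp

text \<open>Tonelli with the sum over the starting point \<open>x\<close> taken first: stationarity
  collapses it to \<open>\<phi> y * \<mu> y\<close>.\<close>

lemma flow_summable:
  assumes "\<And>y. 0 \<le> \<phi> y" "(\<lambda>y. \<phi> y * \<mu> y) summable_on UNIV"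
  shows "(\<lambda>(y, x). \<mu> x * K x y * \<phi> y) summable_on UNIV \<times> UNIV"
    and "((\<lambda>(y, x). \<mu> x * K x y * \<phi> y) has_sum (\<Sum>\<^sub>\<infinity>y. \<phi> y * \<mu> y)) (UNIV \<times> UNIV)"
proof -
  have 1: "((\<lambda>x. \<mu> x * K x y * \<phi> y) has_sum (\<phi> y * \<mu> y)) UNIV" for y
    using has_sum_cmult_left[OF stationary[of y], of "\<phi> y"] by (simp add: mult.commute)
  show s: "(\<lambda>(y, x). \<mu> x * K x y * \<phi> y) summable_on UNIV \<times> UNIV"
    by (rule summable_on_SigmaI[OF _ assms(2)]) (use 1 assms \<mu>_nonneg K_nonneg in auto)
  show "((\<lambda>(y, x). \<mu> x * K x y * \<phi> y) has_sum (\<Sum>\<^sub>\<infinity>y. \<phi> y * \<mu> y)) (UNIV \<times> UNIV)"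
    by (rule has_sum_SigmaI[OF _ has_sum_infsum[OF assms(2)] s]) (use 1 in auto)
qed

text \<open>The same double sum in the other order. As \<open>\<mu> x > 0\<close>, dividing by it
  shows that the series defining \<open>kernel_act K \<phi> x\<close> converges at every
  \<open>x\<close>, so its value is not the default 0 of a divergent \<open>infsum\<close>.\<close>

lemma kernel_act_nonneg:
  assumes "\<And>y. 0 \<le> \<phi> y" "(\<lambda>y. \<phi> y * \<mu> y) summable_on UNIV"
  shows "(\<lambda>y. K x y * \<phi> y) summable_on UNIV"
    and "((\<lambda>x. kernel_act K \<phi> x * \<mu> x) has_sum (\<Sum>\<^sub>\<infinity>y. \<phi> y * \<mu> y)) UNIV"
proof -
  have h: "((\<lambda>(x, y). \<mu> x * K x y * \<phi> y) has_sum (\<Sum>\<^sub>\<infinity>y. \<phi> y * \<mu> y)) (UNIV \<times> UNIV)"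
    using flow_summable(2)[OF assms] by (subst has_sum_swap) simp
  have "(\<lambda>y. \<mu> x * (K x y * \<phi> y)) summable_on UNIV" for x
    using summable_on_SigmaD1[of "\<lambda>x y. \<mu> x * K x y * \<phi> y" UNIV "\<lambda>_. UNIV" x] h
    by (auto simp: summable_on_def mult.assoc)
  then show s: "(\<lambda>y. K x y * \<phi> y) summable_on UNIV" for x
    using summable_on_cmult_right[of "\<lambda>y. \<mu> x * (K x y * \<phi> y)" UNIV "1 / \<mu> x"] pos[of x] by simp
  show "((\<lambda>x. kernel_act K \<phi> x * \<mu> x) has_sum (\<Sum>\<^sub>\<infinity>y. \<phi> y * \<mu> y)) UNIV"
  proof (rule has_sum_Sigma'[OF h])
    show "((\<lambda>y. case (x, y) of (x, y) \<Rightarrow> \<mu> x * K x y * \<phi> y) has_sum kernel_act K \<phi> x * \<mu> x) UNIV" for x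
      using has_sum_cmult_right[OF has_sum_infsum[OF s[of x]], of "\<mu> x"]
      by (simp add: kernel_act_def mult_ac)
  qed
qed

text \<open>Jensen's inequality holds in each row of \<open>K\<close>; summing it against
  \<open>\<mu>\<close> and using invariance gives the contraction.\<close>

lemma
  assumes "1 \<le> r" "f \<in> lp_space r \<mu>"
  shows kernel_act_summable: "(\<lambda>y. K x y * \<bar>f y\<bar>) summable_on UNIV"
    and kernel_act_jensen: "\<bar>kernel_act K f x\<bar> powr r \<le> kernel_act K (\<lambda>y. \<bar>f y\<bar> powr r) x"
    and kernel_act_in_lp: "kernel_act K f \<in> lp_space r \<mu>"
    and kernel_act_contraction:
      "(\<Sum>\<^sub>\<infinity>x. \<bar>kernel_act K f x\<bar> powr r * \<mu> x) \<le> (\<Sum>\<^sub>\<infinity>x. \<bar>f x\<bar> powr r * \<mu> x)"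
proof -
  have f: "(\<lambda>y. \<bar>f y\<bar> powr r * \<mu> y) summable_on UNIV"
    using assms by (simp add: lp_space_def)
  note a = kernel_act_nonneg[OF _ f, simplified]
  show "(\<lambda>y. K x y * \<bar>f y\<bar>) summable_on UNIV"
    using summable_on_weight_le_powr(1)[OF K_nonneg K_summable assms(1) a(1)] .
  show j: "\<bar>kernel_act K f x\<bar> powr r \<le> kernel_act K (\<lambda>y. \<bar>f y\<bar> powr r) x" for x
    unfolding kernel_act_def using jensen_powr_infsum[OF K_nonneg K_sum assms(1) a(1)] .
  have jm: "\<bar>kernel_act K f x\<bar> powr r * \<mu> x \<le> kernel_act K (\<lambda>y. \<bar>f y\<bar> powr r) x * \<mu> x" for x
    using j \<mu>_nonneg by (intro mult_right_mono) auto
  have s: "(\<lambda>x. \<bar>kernel_act K f x\<bar> powr r * \<mu> x) summable_on UNIV"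
    by (rule summable_on_comparison_test[OF _ jm]) (use a(2) \<mu>_nonneg in \<open>auto simp: summable_on_def\<close>)
  then show "kernel_act K f \<in> lp_space r \<mu>" by (simp add: lp_space_def)
  show "(\<Sum>\<^sub>\<infinity>x. \<bar>kernel_act K f x\<bar> powr r * \<mu> x) \<le> (\<Sum>\<^sub>\<infinity>x. \<bar>f x\<bar> powr r * \<mu> x)"
    by (rule has_sum_mono[OF has_sum_infsum[OF s] a(2) jm])
qed

text \<open>The kernel of the adjoint of \<open>K\<close> on \<open>l^2(\<mu>)\<close>.\<close>

definition reversal :: "'v \<Rightarrow> 'v \<Rightarrow> real" where
  "reversal y x = \<mu> x * K x y / \<mu> y"

text \<open>The two hypotheses exchange roles: stationarity of \<open>\<mu>\<close> under
  \<open>K\<close> gives the row sums of the reversal, and the row sums of \<open>K\<close> give its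
  stationarity.\<close>

lemma stationary_kernel_reversal: "stationary_kernel reversal \<mu>"
proof
  have sum: "(reversal y has_sum 1) UNIV" for y
    using has_sum_divide_const[OF stationary[of y], of "\<mu> y"] pos[of y]
    unfolding reversal_def by simp
  have nn: "0 \<le> reversal y x" for x y
    using \<mu>_nonneg K_nonneg by (simp add: reversal_def)
  moreover have "reversal y x \<le> 1" for x y
    using finite_sum_le_has_sum[OF sum, of "{x}" y] nn by auto
  ultimately show "markov_kernel reversal"
    using sum by (auto simp: markov_kernel_def)
  show "((\<lambda>x. \<mu> x * reversal x y) has_sum \<mu> y) UNIV" for y
    using has_sum_cmult_right[OF K_sum, of "\<mu> y" y] pos
    by (simp add: reversal_def less_imp_neq[symmetric])
qed (use pos prob in auto)

end

section \<open>Square-summable functions, the logarithmic Sobolev constant and entropy\<close>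

lemma abs_mult_le_sum_squares: "\<bar>a * b\<bar> \<le> a\<^sup>2 + b\<^sup>2" for a b :: real
proof -
  have "2 * (\<bar>a\<bar> * \<bar>b\<bar>) \<le> a\<^sup>2 + b\<^sup>2"
    using sum_squares_bound[of "\<bar>a\<bar>" "\<bar>b\<bar>"] by (simp add: mult.assoc)
  moreover have "0 \<le> \<bar>a\<bar> * \<bar>b\<bar>" by simp
  ultimately show ?thesis unfolding abs_mult by linarith
qed

lemma lp_space_2_iff: "f \<in> lp_space 2 \<mu> \<longleftrightarrow> (\<lambda>x. (f x)\<^sup>2 * \<mu> x) summable_on UNIV"
  by (simp add: lp_space_def)

lemma finite_support_in_lp_space:
  assumes "finite F" "\<And>x. x \<notin> F \<Longrightarrow> f x = 0"
  shows "f \<in> lp_space p \<mu>"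
  unfolding lp_space_def mem_Collect_eq
  by (rule has_sum_imp_summable[OF has_sum_finite_neutralI[OF assms(1)]]) (use assms in auto)

text \<open>The \<open>GREATEST\<close> in the definition is attained: the admissible constants form a closed set
  containing 0, and one test function of positive finite entropy bounds it.\<close>

lemma log_sobolev_const_spec:
  fixes Q :: "('v \<Rightarrow> real) \<Rightarrow> 'v \<Rightarrow> real"
  assumes nonneg: "\<And>f. f \<in> lp_space 2 \<mu> \<Longrightarrow> 0 \<le> dirichlet_form Q \<mu> f"
    and f0: "f0 \<in> lp_space 2 \<mu>" "\<And>x. 0 \<le> f0 x" "\<nexists>c. \<forall>x. f0 x = c"
    and e0: "entropy_of \<mu> (\<lambda>x. (f0 x)\<^sup>2) = ereal e0" "0 < e0"
  defines "a \<equiv> log_sobolev_const Q \<mu>"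
  shows "0 \<le> a"
    and "\<And>f. f \<in> lp_space 2 \<mu> \<Longrightarrow> (\<And>x. 0 \<le> f x) \<Longrightarrow> \<nexists>c. \<forall>x. f x = c \<Longrightarrow>
      ereal a * entropy_of \<mu> (\<lambda>x. (f x)\<^sup>2) \<le> ereal (dirichlet_form Q \<mu> f)"
proof -
  define P where "P = (\<lambda>a::real. a \<ge> 0 \<and>
     (\<forall>f \<in> lp_space 2 \<mu>. (\<forall>x. f x \<ge> 0) \<and> \<not> (\<exists>c. \<forall>x. f x = c) \<longrightarrow>
        ereal a * entropy_of \<mu> (\<lambda>x. (f x)\<^sup>2) \<le> ereal (dirichlet_form Q \<mu> f)))"
  define M where "M = Sup {a. P a}"
  have P0: "P 0" using nonneg by (simp add: P_def zero_ereal_def[symmetric])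
  have "a \<le> dirichlet_form Q \<mu> f0 / e0" if "P a" for a
    using that f0 e0 by (auto simp: P_def field_simps)
  then have bdd: "bdd_above {a. P a}" by (auto simp: bdd_above_def)
  have M_ge: "a \<le> M" if "P a" for a
    unfolding M_def using that bdd by (intro cSup_upper) auto
  have M0: "0 \<le> M" using M_ge[OF P0] .
  have "ereal M * entropy_of \<mu> (\<lambda>x. (f x)\<^sup>2) \<le> ereal (dirichlet_form Q \<mu> f)"
    if f: "f \<in> lp_space 2 \<mu>" "\<forall>x. 0 \<le> f x" "\<nexists>c. \<forall>x. f x = c" for f
  proof -
    define D where "D = dirichlet_form Q \<mu> f"
    have D: "0 \<le> D" using nonneg[OF f(1)] by (simp add: D_def)
    have Pf: "ereal a * entropy_of \<mu> (\<lambda>x. (f x)\<^sup>2) \<le> ereal D" "0 \<le> a" if "P a" for a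
      using that f by (auto simp: P_def D_def)
    have "ereal M * entropy_of \<mu> (\<lambda>x. (f x)\<^sup>2) \<le> ereal D"
    proof (cases "entropy_of \<mu> (\<lambda>x. (f x)\<^sup>2)")
      case (real e)
      show ?thesis
      proof (cases "0 < e")
        case True
        have "M \<le> D / e"
          unfolding M_def using P0 Pf real True by (intro cSup_least) (auto simp: field_simps)
        then show ?thesis using True real by (simp add: field_simps)
      next
        case False
        then have "M * e \<le> 0" using M0 by (simp add: mult_nonneg_nonpos)
        then show ?thesis using D real by simp
      qed
    next
      \<comment> \<open>Infinite entropy rules out every positive admissible constant, so
        \<open>M = 0\<close>, and the convention 0 times \<infinity> = 0 closes the case.\<close>
      case PInf
      have "M \<le> 0"
        unfolding M_def
      proof (rule cSup_least)
        show "a \<le> 0" if "a \<in> {a. P a}" for a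
          using that Pf[of a] PInf by (cases "a = 0") auto
      qed (use P0 in auto)
      then show ?thesis using M0 D PInf by (simp add: zero_ereal_def[symmetric])
    next
      case MInf
      then show ?thesis using M0 D by (cases "M = 0") (auto simp: zero_ereal_def[symmetric])
    qed
    then show ?thesis by (simp add: D_def)
  qed
  then have "P M" using M0 by (simp add: P_def)
  then have "a = M"
    unfolding a_def log_sobolev_const_def P_def[symmetric]
    using M_ge by (intro Greatest_equality) auto
  with \<open>P M\<close> show "0 \<le> a"
    and "\<And>f. f \<in> lp_space 2 \<mu> \<Longrightarrow> (\<And>x. 0 \<le> f x) \<Longrightarrow> \<nexists>c. \<forall>x. f x = c \<Longrightarrow>
      ereal a * entropy_of \<mu> (\<lambda>x. (f x)\<^sup>2) \<le> ereal (dirichlet_form Q \<mu> f)"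
    by (auto simp: P_def)
qed

text \<open>The convex function $s \mapsto (1 + s) \log \sum u^{1/(1+s)} \mu$ lies above its tangent at
  $s = 0$, whose slope is minus the entropy of $u$ divided by \<open>U\<close>; the bound below is the tangent
  estimate at $s = a$, weakened by $e^{-x} \ge 1 - x$.\<close>

lemma entropy_interpolation:
  fixes u \<mu> :: "'v \<Rightarrow> real"
  assumes "finite F" "0 \<le> a" and u: "\<And>x. 0 \<le> u x" and \<mu>: "\<And>x. 0 \<le> \<mu> x"
    and U: "U = (\<Sum>x\<in>F. u x * \<mu> x)" "0 < U"
  shows "U - a * (\<Sum>x\<in>F. u x * ln (u x / U) * \<mu> x)
    \<le> (\<Sum>x\<in>F. u x powr (1 / (1 + a)) * \<mu> x) powr (1 + a)"
proof -
  \<comment> \<open>Dividing by \<open>U\<close> makes \<open>v\<close> a probability density with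
    respect to \<open>\<mu>\<close> on \<open>F\<close>, with entropy \<open>H\<close>.\<close>
  define v where "v x = u x / U" for x
  have v: "0 \<le> v x" "u x = U * v x" for x using u U by (auto simp: v_def)
  have v1: "(\<Sum>x\<in>F. v x * \<mu> x) = 1"
    using U by (simp add: v_def flip: sum_divide_distrib)
  define H where "H = (\<Sum>x\<in>F. v x * ln (v x) * \<mu> x)"
  \<comment> \<open>With this choice \<open>1 - c = 1 / (1 + a)\<close> and
    \<open>c * (1 + a) = a\<close>.\<close>
  define c where "c = a / (1 + a)"
  define Z where "Z = (\<Sum>x\<in>F. v x powr (1 / (1 + a)) * \<mu> x)"
  \<comment> \<open>This is \<open>1 + y \<le> exp y\<close> at
    \<open>y = c * H - c * ln (v x)\<close>, multiplied by \<open>exp (- (c * H)) * v x\<close>. The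
    shift \<open>c * H\<close> gives \<open>y\<close> mean zero under the weights
    \<open>v x * \<mu> x\<close>, so that summation leaves exactly
    \<open>exp (- (c * H))\<close>.\<close>
  have pt: "exp (- (c * H)) * ((1 + c * H) * v x - c * (v x * ln (v x))) \<le> v x powr (1 / (1 + a))" for x
  proof (cases "v x = 0")
    case False
    then have vp: "0 < v x" using v(1)[of x] by simp
    have ca: "1 / (1 + a) = 1 - c" using assms by (simp add: c_def field_simps)
    have "exp (- (c * H)) * v x * (1 + (c * H - c * ln (v x)))
        \<le> exp (- (c * H)) * v x * exp (c * H - c * ln (v x))"
      using vp by (intro mult_left_mono exp_ge_add_one_self) auto
    also have "\<dots> = exp (- (c * H) + ln (v x) + (c * H - c * ln (v x)))"
      using vp by (simp only: exp_add exp_ln)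
    also have "\<dots> = v x powr (1 / (1 + a))"
      unfolding ca using vp by (simp add: powr_def algebra_simps)
    finally show ?thesis by (simp add: algebra_simps)
  qed simp
  have "exp (- (c * H)) = exp (- (c * H)) * ((1 + c * H) * (\<Sum>x\<in>F. v x * \<mu> x) - c * H)"
    by (simp add: v1)
  also have "\<dots> = (\<Sum>x\<in>F. exp (- (c * H)) * ((1 + c * H) * v x - c * (v x * ln (v x))) * \<mu> x)"
    unfolding H_def[symmetric]
    by (subst (3) H_def) (simp add: sum_distrib_left sum_subtractf[symmetric] algebra_simps)
  also have "\<dots> \<le> Z"
    unfolding Z_def using pt \<mu> by (intro sum_mono mult_right_mono)
  finally have Z: "exp (- (c * H)) \<le> Z" .
  have "1 - a * H \<le> exp (- (a * H))"
    using exp_ge_add_one_self[of "- (a * H)"] by simp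
  also have "\<dots> = exp (- (c * H)) powr (1 + a)"
    using assms by (simp add: powr_def c_def)
  also have "\<dots> \<le> Z powr (1 + a)"
    using Z assms by (intro powr_mono2) auto
  finally have "U * (1 - a * H) \<le> U * Z powr (1 + a)"
    using U by (intro mult_left_mono) auto
  \<comment> \<open>Homogeneity undoes the normalization: \<open>U\<close> enters the bracket as its
    power \<open>1 / (1 + a)\<close>.\<close>
  also have "\<dots> = (U powr (1 / (1 + a)) * Z) powr (1 + a)"
    using U assms(2) by (subst powr_mult) (auto simp: powr_powr)
  also have "U powr (1 / (1 + a)) * Z = (\<Sum>x\<in>F. u x powr (1 / (1 + a)) * \<mu> x)"
    unfolding Z_def v(2) using U v by (simp add: powr_mult sum_distrib_left mult_ac)
  also have "U * (1 - a * H) = U - a * (\<Sum>x\<in>F. u x * ln (u x / U) * \<mu> x)"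
    unfolding H_def v_def using U by (simp add: sum_distrib_left algebra_simps)
  finally show ?thesis .
qed

section \<open>The adjoint on \<open>l^2\<close> and the logarithmic Sobolev inequality\<close>

context stationary_kernel
begin

lemma l2_product_summable:
  assumes "f \<in> lp_space 2 \<mu>" "g \<in> lp_space 2 \<mu>"
  shows "(\<lambda>x. f x * g x * \<mu> x) summable_on UNIV"
proof -
  have "(\<lambda>x. norm (f x * g x * \<mu> x)) summable_on UNIV"
  proof (rule summable_on_comparison_test)
    show "(\<lambda>x. (f x)\<^sup>2 * \<mu> x + (g x)\<^sup>2 * \<mu> x) summable_on UNIV"
      using assms by (intro summable_on_add) (auto simp: lp_space_2_iff)
    have "\<bar>f x * g x\<bar> \<le> (f x)\<^sup>2 + (g x)\<^sup>2" for x
      by (rule abs_mult_le_sum_squares)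
    then have "\<bar>f x * g x\<bar> * \<mu> x \<le> ((f x)\<^sup>2 + (g x)\<^sup>2) * \<mu> x" for x
      using \<mu>_nonneg by (intro mult_right_mono) auto
    then show "norm (f x * g x * \<mu> x) \<le> (f x)\<^sup>2 * \<mu> x + (g x)\<^sup>2 * \<mu> x" for x
      using \<mu>_nonneg by (simp add: abs_mult distrib_right)
  qed auto
  then show ?thesis by (rule abs_summable_summable)
qed

text \<open>Fubini applies because the summand is dominated by \<open>\<mu> x * K x y\<close> times
  \<open>(f y)\<^sup>2 + (g x)\<^sup>2\<close>: the first term is summable by stationarity, the
  second by the row sums. After the exchange,
  \<open>\<mu> x * K x y = \<mu> y * reversal y x\<close>.\<close>

lemma l2_inner_reversal:
  assumes "f \<in> lp_space 2 \<mu>" "g \<in> lp_space 2 \<mu>"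
  shows "l2_inner \<mu> (kernel_act K f) g = l2_inner \<mu> f (kernel_act reversal g)"
proof -
  have f: "(\<lambda>y. (f y)\<^sup>2 * \<mu> y) summable_on UNIV" and g: "(\<lambda>y. (g y)\<^sup>2 * \<mu> y) summable_on UNIV"
    using assms by (auto simp: lp_space_2_iff)
  have 1: "(\<lambda>(x, y). \<mu> x * K x y * (f y)\<^sup>2) summable_on UNIV \<times> UNIV"
    using flow_summable(1)[OF _ f] by (subst summable_on_swap) simp
  have 2: "(\<lambda>(x, y). \<mu> x * K x y * (g x)\<^sup>2) summable_on UNIV \<times> UNIV"
  proof (rule summable_on_SigmaI[OF _ g])
    show "((\<lambda>y. case (x, y) of (x, y) \<Rightarrow> \<mu> x * K x y * (g x)\<^sup>2) has_sum (g x)\<^sup>2 * \<mu> x) UNIV" for x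
      using has_sum_cmult_right[OF K_sum[of x], of "\<mu> x * (g x)\<^sup>2"] by (simp add: mult_ac)
  qed (use \<mu>_nonneg K_nonneg in auto)
  have "(\<lambda>(x, y). norm (\<mu> x * K x y * f y * g x)) summable_on UNIV \<times> UNIV"
  proof (rule summable_on_comparison_test[OF summable_on_add[OF 1 2]], safe)
    fix x y
    have "\<bar>f y * g x\<bar> \<le> (f y)\<^sup>2 + (g x)\<^sup>2"
      by (rule abs_mult_le_sum_squares)
    then have "\<mu> x * K x y * \<bar>f y * g x\<bar> \<le> \<mu> x * K x y * ((f y)\<^sup>2 + (g x)\<^sup>2)"
      using \<mu>_nonneg K_nonneg by (intro mult_left_mono) auto
    then show "norm (\<mu> x * K x y * f y * g x) \<le> \<mu> x * K x y * (f y)\<^sup>2 + \<mu> x * K x y * (g x)\<^sup>2"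
      using \<mu>_nonneg K_nonneg by (simp add: abs_mult distrib_left mult.assoc)
  qed auto
  then have s: "(\<lambda>(x, y). \<mu> x * K x y * f y * g x) summable_on UNIV \<times> UNIV"
    by - (rule abs_summable_summable, simp add: case_prod_unfold)
  have "kernel_act K f x * g x * \<mu> x = (\<Sum>\<^sub>\<infinity>y. \<mu> x * K x y * f y * g x)" for x
    using infsum_cmult_right'[of "\<mu> x * g x" "\<lambda>y. K x y * f y" UNIV]
    by (simp add: kernel_act_def mult_ac)
  then have "l2_inner \<mu> (kernel_act K f) g = (\<Sum>\<^sub>\<infinity>x. \<Sum>\<^sub>\<infinity>y. \<mu> x * K x y * f y * g x)"
    by (simp add: l2_inner_def)
  also have "\<dots> = (\<Sum>\<^sub>\<infinity>y. \<Sum>\<^sub>\<infinity>x. \<mu> x * K x y * f y * g x)"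
    by (rule infsum_swap_banach[OF s])
  also have "\<dots> = (\<Sum>\<^sub>\<infinity>y. \<Sum>\<^sub>\<infinity>x. f y * (reversal y x * g x) * \<mu> y)"
    by (intro infsum_cong) (use pos in \<open>auto simp: reversal_def less_imp_neq[symmetric]\<close>)
  also have "\<dots> = l2_inner \<mu> f (kernel_act reversal g)"
    unfolding l2_inner_def kernel_act_def
    by (simp add: infsum_cmult_right' infsum_cmult_left')
  finally show ?thesis .
qed

text \<open>This resolves the \<open>THE\<close> in \<open>l2_adjoint\<close>. Existence is the
  duality just proved; uniqueness follows by testing against the indicator of a point, which
  \<open>\<mu>\<close> charges.\<close>

lemma l2_adjoint_eq_reversal:
  assumes "g \<in> lp_space 2 \<mu>"
  shows "l2_adjoint \<mu> (kernel_act K) g = kernel_act reversal g"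
  unfolding l2_adjoint_def
proof (rule the_equality, safe)
  interpret R: stationary_kernel reversal \<mu> by (rule stationary_kernel_reversal)
  show "kernel_act reversal g \<in> lp_space 2 \<mu>"
    using R.kernel_act_in_lp[OF _ assms] by simp
  show "l2_inner \<mu> (kernel_act K f) g = l2_inner \<mu> f (kernel_act reversal g)"
    if "f \<in> lp_space 2 \<mu>" for f
    using l2_inner_reversal[OF that assms] .
next
  fix h assume h: "\<forall>f\<in>lp_space 2 \<mu>. l2_inner \<mu> (kernel_act K f) g = l2_inner \<mu> f h"
  show "h = kernel_act reversal g"
  proof
    fix z
    let ?d = "\<lambda>x :: 'v. if x = z then 1 else 0 :: real"
    have d: "?d \<in> lp_space 2 \<mu>" by (rule finite_support_in_lp_space[of "{z}"]) auto
    have "l2_inner \<mu> ?d k = k z * \<mu> z" for k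
      unfolding l2_inner_def by (rule infsumI, rule has_sum_finite_neutralI[of "{z}"]) auto
    then have "h z * \<mu> z = kernel_act reversal g z * \<mu> z"
      using h d l2_inner_reversal[OF d assms] by simp
    then show "h z = kernel_act reversal g z" using pos[of z] by simp
  qed
qed

text \<open>Moving the adjoint across the inner product turns the second term into the squared norm
  of \<open>kernel_act K f\<close>. The series may be split because \<open>f\<close> and its image
  \<open>h\<close> both lie in \<open>l^2\<close>.\<close>

lemma dirichlet_form_eq:
  assumes "f \<in> lp_space 2 \<mu>"
  shows "dirichlet_form (l2_adjoint \<mu> (kernel_act K) \<circ> kernel_act K) \<mu> f
    = (\<Sum>\<^sub>\<infinity>x. (f x)\<^sup>2 * \<mu> x) - (\<Sum>\<^sub>\<infinity>x. (kernel_act K f x)\<^sup>2 * \<mu> x)"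
proof -
  interpret R: stationary_kernel reversal \<mu> by (rule stationary_kernel_reversal)
  have Kf: "kernel_act K f \<in> lp_space 2 \<mu>" using kernel_act_in_lp[OF _ assms] by simp
  define h where "h = kernel_act reversal (kernel_act K f)"
  have h: "h \<in> lp_space 2 \<mu>" using R.kernel_act_in_lp[OF _ Kf] by (simp add: h_def)
  have "dirichlet_form (l2_adjoint \<mu> (kernel_act K) \<circ> kernel_act K) \<mu> f
      = (\<Sum>\<^sub>\<infinity>x. f x * f x * \<mu> x + - (f x * h x * \<mu> x))"
    unfolding dirichlet_form_def l2_inner_def o_def l2_adjoint_eq_reversal[OF Kf] h_def[symmetric]
    by (simp add: algebra_simps)
  also have "\<dots> = (\<Sum>\<^sub>\<infinity>x. f x * f x * \<mu> x) + (\<Sum>\<^sub>\<infinity>x. - (f x * h x * \<mu> x))"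
    using l2_product_summable[OF assms assms] l2_product_summable[OF assms h]
    by (intro infsum_add) (auto simp: summable_on_uminus)
  also have "\<dots> = (\<Sum>\<^sub>\<infinity>x. f x * f x * \<mu> x) - l2_inner \<mu> f h"
    by (simp add: infsum_uminus l2_inner_def)
  also have "l2_inner \<mu> f h = l2_inner \<mu> (kernel_act K f) (kernel_act K f)"
    unfolding h_def using l2_inner_reversal[OF assms Kf] by simp
  finally show ?thesis unfolding l2_inner_def power2_eq_square .
qed

text \<open>Contraction makes the Dirichlet form non-negative. The test function of positive finite
  entropy is the indicator of a point \<open>z\<close>: its entropy is
  \<open>ln (1 / \<mu> z) * \<mu> z\<close>, positive because a second point forces
  \<open>\<mu> z < 1\<close>.\<close>

lemma log_sobolev:
  assumes "\<exists>x y :: 'v. x \<noteq> y"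
  defines "a \<equiv> log_sobolev_const (l2_adjoint \<mu> (kernel_act K) \<circ> kernel_act K) \<mu>"
  shows log_sobolev_nonneg: "0 \<le> a"
    and log_sobolev_inequality: "\<And>f. f \<in> lp_space 2 \<mu> \<Longrightarrow> (\<And>x. 0 \<le> f x) \<Longrightarrow> \<nexists>c. \<forall>x. f x = c \<Longrightarrow>
      ereal a * entropy_of \<mu> (\<lambda>x. (f x)\<^sup>2)
        \<le> ereal ((\<Sum>\<^sub>\<infinity>x. (f x)\<^sup>2 * \<mu> x) - (\<Sum>\<^sub>\<infinity>x. (kernel_act K f x)\<^sup>2 * \<mu> x))"
proof -
  let ?Q = "l2_adjoint \<mu> (kernel_act K) \<circ> kernel_act K"
  obtain z w :: 'v where zw: "z \<noteq> w" using assms by auto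
  have nn: "0 \<le> dirichlet_form ?Q \<mu> f" if "f \<in> lp_space 2 \<mu>" for f
    using kernel_act_contraction[OF _ that] dirichlet_form_eq[OF that] by simp
  let ?d = "\<lambda>x :: 'v. if x = z then 1 else 0 :: real"
  have d: "?d \<in> lp_space 2 \<mu>" by (rule finite_support_in_lp_space[of "{z}"]) auto
  have dc: "\<nexists>c. \<forall>x. ?d x = c" using zw by (metis zero_neq_one)
  have U: "(\<Sum>\<^sub>\<infinity>x. (?d x)\<^sup>2 * \<mu> x) = \<mu> z"
    by (rule infsumI, rule has_sum_finite_neutralI[of "{z}"]) auto
  have "((\<lambda>x. (?d x)\<^sup>2 * ln ((?d x)\<^sup>2 / \<mu> z) * \<mu> x) has_sum (ln (1 / \<mu> z) * \<mu> z)) UNIV"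
    by (rule has_sum_finite_neutralI[of "{z}"]) auto
  then have e: "entropy_of \<mu> (\<lambda>x. (?d x)\<^sup>2) = ereal (ln (1 / \<mu> z) * \<mu> z)"
    unfolding entropy_of_def Let_def U using has_sum_imp_summable infsumI by fastforce
  have "\<mu> z + \<mu> w \<le> 1"
    using finite_sum_le_has_sum[OF prob, of "{z, w}"] \<mu>_nonneg zw by simp
  then have e0: "0 < ln (1 / \<mu> z) * \<mu> z"
    using pos[of z] pos[of w] by (intro mult_pos_pos ln_gt_zero) auto
  note spec = log_sobolev_const_spec[OF nn d _ dc e e0]
  show "0 \<le> a" unfolding a_def using spec(1) by simp
  show "ereal a * entropy_of \<mu> (\<lambda>x. (f x)\<^sup>2)
        \<le> ereal ((\<Sum>\<^sub>\<infinity>x. (f x)\<^sup>2 * \<mu> x) - (\<Sum>\<^sub>\<infinity>x. (kernel_act K f x)\<^sup>2 * \<mu> x))"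
    if "f \<in> lp_space 2 \<mu>" "\<And>x. 0 \<le> f x" "\<nexists>c. \<forall>x. f x = c" for f
    using spec(2)[of f] that dirichlet_form_eq[OF that(1)] by (simp add: a_def)
qed

section \<open>Hypercontractivity of one step\<close>

text \<open>Finite support puts \<open>g = f^(p/2)\<close> in \<open>l^2\<close>, which can fail for
  \<open>f\<close> in \<open>l^q\<close> when \<open>p > q\<close>, and makes the entropy of its
  square a real number.\<close>

lemma hypercontractive_finite_support:
  assumes ne: "\<exists>x y :: 'v. x \<noteq> y"
    and q: "2 \<le> q" and F: "finite F" "\<And>x. x \<notin> F \<Longrightarrow> f x = 0" and f: "\<And>x. 0 \<le> f x"
  defines "a \<equiv> log_sobolev_const (l2_adjoint \<mu> (kernel_act K) \<circ> kernel_act K) \<mu>"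
  shows "(\<lambda>x. \<bar>kernel_act K f x\<bar> powr (q * (1 + a)) * \<mu> x) summable_on UNIV"
    and "(\<Sum>\<^sub>\<infinity>x. \<bar>kernel_act K f x\<bar> powr (q * (1 + a)) * \<mu> x)
      \<le> (\<Sum>x\<in>F. f x powr q * \<mu> x) powr (1 + a)"
proof -
  have a: "0 \<le> a" unfolding a_def using log_sobolev_nonneg[OF ne] .
  define p where "p = q * (1 + a)"
  \<comment> \<open>Jensen's inequality is used below with exponent \<open>p / 2\<close>, which must
    be at least 1.\<close>
  have p: "2 \<le> p" unfolding p_def using q a mult_mono[of 2 q 1 "1 + a"] by simp
  define g where "g x = f x powr (p / 2)" for x
  have g0: "0 \<le> g x" for x by (simp add: g_def)
  have gF: "g x = 0" if "x \<notin> F" for x using F(2)[OF that] by (simp add: g_def)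
  have g: "g \<in> lp_space 2 \<mu>" by (rule finite_support_in_lp_space[OF F(1) gF])
  have Kg: "(\<lambda>x. (kernel_act K g x)\<^sup>2 * \<mu> x) summable_on UNIV"
    using kernel_act_in_lp[OF _ g] by (simp add: lp_space_2_iff)
  have le: "\<bar>kernel_act K f x\<bar> powr p * \<mu> x \<le> (kernel_act K g x)\<^sup>2 * \<mu> x" for x
  proof -
    have "f \<in> lp_space (p / 2) \<mu>" by (rule finite_support_in_lp_space[OF F])
    then have "\<bar>kernel_act K f x\<bar> powr (p / 2) \<le> kernel_act K g x"
      using kernel_act_jensen[of "p / 2" f x] p f by (simp add: g_def[abs_def])
    then have "(\<bar>kernel_act K f x\<bar> powr (p / 2))\<^sup>2 \<le> (kernel_act K g x)\<^sup>2"
      by (intro power_mono) auto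
    moreover have "(\<bar>kernel_act K f x\<bar> powr (p / 2))\<^sup>2 = \<bar>kernel_act K f x\<bar> powr p"
      by (simp add: power2_eq_square flip: powr_add)
    ultimately show ?thesis using \<mu>_nonneg by (intro mult_right_mono) auto
  qed
  show s: "(\<lambda>x. \<bar>kernel_act K f x\<bar> powr (q * (1 + a)) * \<mu> x) summable_on UNIV"
    unfolding p_def[symmetric]
    by (rule summable_on_comparison_test[OF Kg le]) (use \<mu>_nonneg in auto)
  define U where "U = (\<Sum>x\<in>F. (g x)\<^sup>2 * \<mu> x)"
  define e where "e = (\<Sum>x\<in>F. (g x)\<^sup>2 * ln ((g x)\<^sup>2 / U) * \<mu> x)"
  have "((\<lambda>x. (g x)\<^sup>2 * \<mu> x) has_sum U) UNIV"
    by (rule has_sum_finite_neutralI[OF F(1)]) (auto simp: gF U_def)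
  then have U: "(\<Sum>\<^sub>\<infinity>x. (g x)\<^sup>2 * \<mu> x) = U" by (rule infsumI)
  have "((\<lambda>x. (g x)\<^sup>2 * ln ((g x)\<^sup>2 / U) * \<mu> x) has_sum e) UNIV"
    by (rule has_sum_finite_neutralI[OF F(1)]) (auto simp: gF e_def)
  then have ent: "entropy_of \<mu> (\<lambda>x. (g x)\<^sup>2) = ereal e"
    unfolding entropy_of_def Let_def U using has_sum_imp_summable infsumI by fastforce
  have contr: "(\<Sum>\<^sub>\<infinity>x. (kernel_act K g x)\<^sup>2 * \<mu> x) \<le> U"
    using kernel_act_contraction[OF _ g] U by simp
  \<comment> \<open>The logarithmic Sobolev inequality excludes constant \<open>g\<close>; there the
    entropy is 0 and contraction alone suffices.\<close>
  have ls: "(\<Sum>\<^sub>\<infinity>x. (kernel_act K g x)\<^sup>2 * \<mu> x) \<le> U - a * e"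
  proof (cases "\<exists>c. \<forall>x. g x = c")
    case True
    then obtain c where c: "g x = c" for x by auto
    have "(\<Sum>\<^sub>\<infinity>x. (g x)\<^sup>2 * \<mu> x) = c\<^sup>2"
      using infsumI[OF has_sum_cmult_right[OF prob, of "c\<^sup>2"]] by (simp add: c)
    then have "e = 0" using U by (simp add: e_def c)
    then show ?thesis using contr by simp
  next
    case False
    have "ereal a * ereal e \<le> ereal (U - (\<Sum>\<^sub>\<infinity>x. (kernel_act K g x)\<^sup>2 * \<mu> x))"
      using log_sobolev_inequality[OF ne g g0 False] by (simp add: a_def ent U)
    then show ?thesis by simp
  qed
  \<comment> \<open>As \<open>p / (1 + a) = q\<close>, the interpolated sum of
    \<open>g\<^sup>2\<close> is the \<open>q\<close>-th power sum of \<open>f\<close>.\<close>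
  have gq: "(g x)\<^sup>2 powr (1 / (1 + a)) = f x powr q" for x
  proof -
    have "(g x)\<^sup>2 = f x powr p"
      by (simp add: g_def power2_eq_square flip: powr_add)
    then show ?thesis using a by (simp add: powr_powr p_def)
  qed
  have "(\<Sum>\<^sub>\<infinity>x. \<bar>kernel_act K f x\<bar> powr p * \<mu> x) \<le> (\<Sum>\<^sub>\<infinity>x. (kernel_act K g x)\<^sup>2 * \<mu> x)"
    using s Kg le by (intro infsum_mono) (auto simp: p_def)
  also have "\<dots> \<le> (\<Sum>x\<in>F. f x powr q * \<mu> x) powr (1 + a)"
  proof (cases "0 < U")
    case True
    have "U - a * e \<le> (\<Sum>x\<in>F. f x powr q * \<mu> x) powr (1 + a)"
      using entropy_interpolation[OF F(1) a _ \<mu>_nonneg U_def True] by (simp add: e_def gq)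
    with ls show ?thesis by simp
  next
    case False
    then have "(\<Sum>\<^sub>\<infinity>x. (kernel_act K g x)\<^sup>2 * \<mu> x) \<le> 0" using contr by simp
    also have "0 \<le> (\<Sum>x\<in>F. f x powr q * \<mu> x) powr (1 + a)" by simp
    finally show ?thesis .
  qed
  finally show "(\<Sum>\<^sub>\<infinity>x. \<bar>kernel_act K f x\<bar> powr (q * (1 + a)) * \<mu> x)
      \<le> (\<Sum>x\<in>F. f x powr q * \<mu> x) powr (1 + a)"
    by (simp add: p_def)
qed

text \<open>Two truncations are removed in turn: \<open>F\<close> in the sum defining
  \<open>K|f|\<close>, then \<open>A\<close> in the outer sum. The bound is uniform in both, so
  summability of the \<open>p\<close>-th power of \<open>|K f|\<close> comes out as a
  conclusion.\<close>

proposition hypercontractive: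
  assumes ne: "\<exists>x y :: 'v. x \<noteq> y" and q: "2 \<le> q" and f: "f \<in> lp_space q \<mu>"
  defines "a \<equiv> log_sobolev_const (l2_adjoint \<mu> (kernel_act K) \<circ> kernel_act K) \<mu>"
  shows "kernel_act K f \<in> lp_space (q * (1 + a)) \<mu>"
    and "lp_norm (q * (1 + a)) \<mu> (kernel_act K f) \<le> lp_norm q \<mu> f"
proof -
  have a: "0 \<le> a" unfolding a_def using log_sobolev_nonneg[OF ne] .
  define p where "p = q * (1 + a)"
  have p: "0 < p" using q a by (simp add: p_def)
  define S where "S = (\<Sum>\<^sub>\<infinity>x. \<bar>f x\<bar> powr q * \<mu> x)"
  have fs: "(\<lambda>x. \<bar>f x\<bar> powr q * \<mu> x) summable_on UNIV" using f by (simp add: lp_space_def)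
  have S0: "0 \<le> S" unfolding S_def using \<mu>_nonneg by (intro infsum_nonneg) auto
  have Ks: "(\<lambda>y. K x y * \<bar>f y\<bar>) summable_on UNIV" for x
    using kernel_act_summable[OF _ f] q by simp
  define h where "h x = (\<Sum>\<^sub>\<infinity>y. K x y * \<bar>f y\<bar>)" for x
  have h: "\<bar>kernel_act K f x\<bar> \<le> h x" for x
    using norm_infsum_bound[of "\<lambda>y. K x y * f y" UNIV] Ks[of x] K_nonneg
    by (simp add: abs_mult kernel_act_def h_def)
  have trunc: "(\<Sum>x\<in>A. \<bar>\<Sum>y\<in>F. K x y * \<bar>f y\<bar>\<bar> powr p * \<mu> x) \<le> S powr (1 + a)"
    if A: "finite A" and F: "finite F" for A F
  proof -
    define k where "k y = (if y \<in> F then \<bar>f y\<bar> else 0)" for y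
    have "kernel_act K k x = (\<Sum>y\<in>F. K x y * \<bar>f y\<bar>)" for x
      unfolding kernel_act_def
      by (rule infsumI, rule has_sum_finite_neutralI[OF F]) (auto simp: k_def)
    then have "(\<Sum>x\<in>A. \<bar>\<Sum>y\<in>F. K x y * \<bar>f y\<bar>\<bar> powr p * \<mu> x)
        = (\<Sum>x\<in>A. \<bar>kernel_act K k x\<bar> powr p * \<mu> x)"
      by simp
    also have "\<dots> \<le> (\<Sum>\<^sub>\<infinity>x. \<bar>kernel_act K k x\<bar> powr p * \<mu> x)"
      using hypercontractive_finite_support(1)[OF ne q F, of k] A \<mu>_nonneg
      by (intro finite_sum_le_infsum) (auto simp: k_def p_def a_def)
    also have "\<dots> \<le> (\<Sum>x\<in>F. k x powr q * \<mu> x) powr (1 + a)"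
      using hypercontractive_finite_support(2)[OF ne q F, of k] by (auto simp: k_def p_def a_def)
    also have "\<dots> = (\<Sum>x\<in>F. \<bar>f x\<bar> powr q * \<mu> x) powr (1 + a)"
      by (simp add: k_def)
    also have "\<dots> \<le> S powr (1 + a)"
    proof (rule powr_mono2)
      show "(\<Sum>x\<in>F. \<bar>f x\<bar> powr q * \<mu> x) \<le> S"
        unfolding S_def using \<mu>_nonneg F by (intro finite_sum_le_infsum[OF fs]) auto
    qed (use a \<mu>_nonneg in \<open>auto intro!: sum_nonneg\<close>)
    finally show ?thesis .
  qed
  have bound: "(\<Sum>x\<in>A. \<bar>kernel_act K f x\<bar> powr p * \<mu> x) \<le> S powr (1 + a)" if A: "finite A" for A
  proof -
    \<comment> \<open>As \<open>A\<close> is finite, the limit along finite sets \<open>F\<close>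
      passes through the outer sum term by term.\<close>
    have "((\<lambda>F. \<Sum>x\<in>A. \<bar>\<Sum>y\<in>F. K x y * \<bar>f y\<bar>\<bar> powr p * \<mu> x) \<longlongrightarrow> (\<Sum>x\<in>A. \<bar>h x\<bar> powr p * \<mu> x))
        (finite_subsets_at_top UNIV)"
      using p unfolding h_def
      by (intro tendsto_sum tendsto_mult tendsto_powr2 tendsto_rabs infsum_tendsto Ks tendsto_const) auto
    then have "(\<Sum>x\<in>A. \<bar>h x\<bar> powr p * \<mu> x) \<le> S powr (1 + a)"
    proof (rule tendsto_upperbound)
      show "\<forall>\<^sub>F F in finite_subsets_at_top UNIV.
          (\<Sum>x\<in>A. \<bar>\<Sum>y\<in>F. K x y * \<bar>f y\<bar>\<bar> powr p * \<mu> x) \<le> S powr (1 + a)"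
        by (rule eventually_finite_subsets_at_top_weakI) (use trunc A in auto)
    qed simp
    moreover have "(\<Sum>x\<in>A. \<bar>kernel_act K f x\<bar> powr p * \<mu> x) \<le> (\<Sum>x\<in>A. \<bar>h x\<bar> powr p * \<mu> x)"
      using p \<mu>_nonneg order_trans[OF h abs_ge_self]
      by (intro sum_mono mult_right_mono powr_mono2) auto
    ultimately show ?thesis by linarith
  qed
  have s: "(\<lambda>x. \<bar>kernel_act K f x\<bar> powr p * \<mu> x) summable_on UNIV"
    by (rule nonneg_bdd_above_summable_on) (use \<mu>_nonneg bound in \<open>auto simp: bdd_above_def\<close>)
  then show "kernel_act K f \<in> lp_space (q * (1 + a)) \<mu>" by (simp add: lp_space_def p_def)
  have "(\<Sum>\<^sub>\<infinity>x. \<bar>kernel_act K f x\<bar> powr p * \<mu> x) \<le> S powr (1 + a)"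
    using bound by (intro infsum_le_finite_sums[OF s])
  then have "(\<Sum>\<^sub>\<infinity>x. \<bar>kernel_act K f x\<bar> powr p * \<mu> x) powr (1 / p) \<le> (S powr (1 + a)) powr (1 / p)"
    using p \<mu>_nonneg by (intro powr_mono2 infsum_nonneg) auto
  also have "\<dots> = S powr (1 / q)"
    using a q by (simp add: powr_powr p_def)
  finally show "lp_norm (q * (1 + a)) \<mu> (kernel_act K f) \<le> lp_norm q \<mu> f"
    by (simp add: lp_norm_def p_def S_def)
qed

end

section \<open>Change of measure and the induction over time\<close>

lemma lp_space_normalized:
  assumes "0 < mass \<pi>"
  shows "lp_space p (normalized \<pi>) = lp_space p \<pi>"
proof -
  have "((\<lambda>x. g x * \<pi> x / mass \<pi>) summable_on UNIV) = ((\<lambda>x. g x * \<pi> x) summable_on UNIV)" for g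
    using assms summable_on_cmult_left'[of "1 / mass \<pi>" "\<lambda>x. g x * \<pi> x" UNIV] by simp
  then show ?thesis by (simp add: lp_space_def normalized_def)
qed

lemma lp_norm_normalized:
  assumes "0 < mass \<pi>" "\<And>x. 0 \<le> \<pi> x"
  shows "lp_norm p (normalized \<pi>) f = lp_norm p \<pi> f / mass \<pi> powr (1 / p)"
proof -
  have "(\<Sum>\<^sub>\<infinity>x. \<bar>f x\<bar> powr p * (\<pi> x / mass \<pi>)) = (\<Sum>\<^sub>\<infinity>x. \<bar>f x\<bar> powr p * \<pi> x) / mass \<pi>"
    using infsum_cmult_left'[of "\<lambda>x. \<bar>f x\<bar> powr p * \<pi> x" "1 / mass \<pi>" UNIV] by simp
  then show ?thesis
    using assms by (simp add: lp_norm_def normalized_def powr_divide infsum_nonneg)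
qed

lemma lp_norm_mono_measure:
  assumes "0 < p" "\<And>x. 0 \<le> \<pi> x" "\<And>x. \<pi> x \<le> \<rho> x" "f \<in> lp_space p \<rho>"
  shows "f \<in> lp_space p \<pi>" "lp_norm p \<pi> f \<le> lp_norm p \<rho> f"
proof -
  have le: "\<bar>f x\<bar> powr p * \<pi> x \<le> \<bar>f x\<bar> powr p * \<rho> x" for x
    using assms by (intro mult_left_mono) auto
  have r: "(\<lambda>x. \<bar>f x\<bar> powr p * \<rho> x) summable_on UNIV" using assms by (simp add: lp_space_def)
  have s: "(\<lambda>x. \<bar>f x\<bar> powr p * \<pi> x) summable_on UNIV"
    by (rule summable_on_comparison_test[OF r le]) (use assms in auto)
  then show "f \<in> lp_space p \<pi>" by (simp add: lp_space_def)
  show "lp_norm p \<pi> f \<le> lp_norm p \<rho> f"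
    unfolding lp_norm_def using assms le r s
    by (intro powr_mono2 infsum_mono infsum_nonneg) auto
qed

lemma environment_stationary_kernel:
  assumes "markov_kernel (K t)" "finite_nondecreasing_environment K \<pi>" "1 \<le> t"
  shows "0 < mass (\<pi> t)" "stationary_kernel (K t) (normalized (\<pi> t))"
proof -
  have env: "\<And>x. 0 < \<pi> t x" "\<And>y. ((\<lambda>x. \<pi> t x * K t x y) has_sum \<pi> t y) UNIV" "\<pi> t summable_on UNIV"
    using assms by (auto simp: finite_nondecreasing_environment_def)
  \<comment> \<open>\<open>undefined\<close> serves as an arbitrary point of \<open>V\<close>; its
    mass alone is already positive.\<close>
  show m: "0 < mass (\<pi> t)"
    using finite_sum_le_infsum[OF env(3), of "{undefined}"] env(1)
    by (force simp: mass_def less_imp_le intro: less_le_trans)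
  show "stationary_kernel (K t) (normalized (\<pi> t))"
  proof
    show "(normalized (\<pi> t) has_sum 1) UNIV"
      using has_sum_divide_const[OF has_sum_infsum[OF env(3)], of "mass (\<pi> t)"] m
      by (simp add: normalized_def mass_def)
    show "((\<lambda>x. normalized (\<pi> t) x * K t x y) has_sum normalized (\<pi> t) y) UNIV" for y
      using has_sum_divide_const[OF env(2)[of y], of "mass (\<pi> t)"] by (simp add: normalized_def)
  qed (use assms m env in \<open>auto simp: normalized_def\<close>)
qed

theorem theorem3p16:
  fixes K :: "nat \<Rightarrow> 'v::countable \<Rightarrow> 'v \<Rightarrow> real"
    and \<pi> :: "nat \<Rightarrow> 'v \<Rightarrow> real"
    and \<alpha> :: "nat \<Rightarrow> real"
    and q p :: real and t :: nat and f :: "'v \<Rightarrow> real"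
  assumes "\<exists>x y :: 'v. x \<noteq> y"
    and "\<And>s. s \<ge> 1 \<Longrightarrow> markov_kernel (K s)"
    and "\<And>s. s \<ge> 1 \<Longrightarrow> irreducible_kernel (K s)"
    and "\<And>s. s \<ge> 1 \<Longrightarrow> aperiodic_kernel (K s)"
    and "finite_nondecreasing_environment K \<pi>"
    and "\<And>s. s \<ge> 1 \<Longrightarrow> \<alpha> s = log_sobolev_const
           (l2_adjoint (normalized (\<pi> s)) (kernel_act (K s)) \<circ> kernel_act (K s))
           (normalized (\<pi> s))"
    and "q \<ge> 2" and "t \<ge> 1"
    and "1 \<le> p" and "p \<le> q * (\<Prod>s=1..t. 1 + \<alpha> s)"
    and "f \<in> lp_space q (\<pi> t)"
  shows "kernel_prod_act K t f \<in> lp_space p (normalized (\<pi> 1)) \<and>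
         lp_norm p (normalized (\<pi> 1)) (kernel_prod_act K t f)
           \<le> lp_norm q (normalized (\<pi> t)) f * (mass (\<pi> t) / mass (\<pi> 1)) powr (1 / q)"
proof -
  note ne = assms(1)
  have mass_pos: "0 < mass (\<pi> s)" and stat: "stationary_kernel (K s) (normalized (\<pi> s))"
    if "1 \<le> s" for s
    using environment_stationary_kernel[OF assms(2)[OF that] assms(5) that] by auto
  have pos: "0 \<le> \<pi> s x" and incr: "\<pi> s x \<le> \<pi> (Suc s) x" and summ: "\<pi> s summable_on UNIV"
    if "1 \<le> s" for s x
    using assms(5) that by (auto simp: finite_nondecreasing_environment_def less_imp_le)
  have mass_mono: "mass (\<pi> s) \<le> mass (\<pi> (Suc s))" if "1 \<le> s" for s
    unfolding mass_def using that by (intro infsum_mono summ incr) auto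
  have mass_mono_1: "mass (\<pi> 1) \<le> mass (\<pi> s)" if "1 \<le> s" for s
    using that
  proof (induction s rule: nat_induct_at_least)
    case (Suc s)
    then show ?case using mass_mono[of s] by linarith
  qed simp
  have \<alpha>_nonneg: "0 \<le> \<alpha> s" if "1 \<le> s" for s
    using stationary_kernel.log_sobolev_nonneg[OF stat[OF that] ne] assms(6)[OF that] by simp
  have step: "kernel_act (K s) f \<in> lp_space (q * (1 + \<alpha> s)) (normalized (\<pi> s))"
    "lp_norm (q * (1 + \<alpha> s)) (normalized (\<pi> s)) (kernel_act (K s) f) \<le> lp_norm q (normalized (\<pi> s)) f"
    if "1 \<le> s" "2 \<le> q" "f \<in> lp_space q (\<pi> s)" for s q f
    using stationary_kernel.hypercontractive[OF stat[OF that(1)] ne that(2)] that(1,3)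
    by (auto simp: assms(6)[OF that(1)] lp_space_normalized[OF mass_pos[OF that(1)]])
  show ?thesis
    using assms(8) assms(7,10,11)
  \<comment> \<open>The induction hypothesis is applied to \<open>K (Suc t)\<close> acting on
    \<open>f\<close> with the improved exponent, hence the generalization over \<open>f\<close> and
    \<open>q\<close>; \<open>p\<close> stays fixed.\<close>
  proof (induction t arbitrary: q f rule: nat_induct_at_least)
    case base
    interpret S: stationary_kernel "K 1" "normalized (\<pi> 1)" by (rule stat) simp
    \<comment> \<open>At time 1 the mass ratio is 1, and monotonicity of the norms under a
      probability passes from \<open>q * (1 + \<alpha> 1)\<close> down to \<open>p\<close>.\<close>
    show ?case
      using step[of 1 q f] base mass_pos[of 1] assms(9)
        lp_space_lp_norm_mono[OF S.\<mu>_nonneg S.prob assms(9), of "q * (1 + \<alpha> 1)" "kernel_act (K 1) f"]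
      by simp
  next
    case (Suc t)
    define r where "r = q * (1 + \<alpha> (Suc t))"
    define g where "g = kernel_act (K (Suc t)) f"
    have qr: "q \<le> r" using \<alpha>_nonneg[of "Suc t"] Suc.prems(1) by (simp add: r_def)
    have g: "g \<in> lp_space r (\<pi> (Suc t))"
      "lp_norm r (normalized (\<pi> (Suc t))) g \<le> lp_norm q (normalized (\<pi> (Suc t))) f"
      using step[of "Suc t" q f] Suc.prems
      by (auto simp: g_def r_def lp_space_normalized[OF mass_pos])
    \<comment> \<open>The passage to the smaller measure is made before normalization, where the
      norm is monotone in the measure.\<close>
    have gt: "g \<in> lp_space r (\<pi> t)" "lp_norm r (\<pi> t) g \<le> lp_norm r (\<pi> (Suc t)) g"
      using lp_norm_mono_measure[OF _ pos[OF Suc.hyps] incr[OF Suc.hyps] g(1)] qr Suc.prems(1)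
      by auto
    have IH: "kernel_prod_act K t g \<in> lp_space p (normalized (\<pi> 1))"
      "lp_norm p (normalized (\<pi> 1)) (kernel_prod_act K t g)
        \<le> lp_norm r (normalized (\<pi> t)) g * (mass (\<pi> t) / mass (\<pi> 1)) powr (1 / r)"
    proof -
      \<comment> \<open>The last factor of the product has been absorbed into \<open>r\<close>, so
        the range allowed for \<open>p\<close> is unchanged.\<close>
      have "p \<le> r * (\<Prod>s=1..t. 1 + \<alpha> s)"
        using Suc.prems(2) by (simp add: r_def mult_ac)
      moreover have "2 \<le> r" using qr Suc.prems(1) by simp
      ultimately show "kernel_prod_act K t g \<in> lp_space p (normalized (\<pi> 1))"
        "lp_norm p (normalized (\<pi> 1)) (kernel_prod_act K t g)
          \<le> lp_norm r (normalized (\<pi> t)) g * (mass (\<pi> t) / mass (\<pi> 1)) powr (1 / r)"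
        using Suc.IH[OF _ _ gt(1)] by blast+
    qed
    \<comment> \<open>The mass of \<open>\<pi> s\<close> cancels. What remains depends on
      \<open>s\<close> only through the unnormalized norm, so \<open>gt\<close> compares times
      \<open>t\<close> and \<open>Suc t\<close>.\<close>
    have scale: "lp_norm r (normalized (\<pi> s)) g * (mass (\<pi> s) / mass (\<pi> 1)) powr (1 / r)
        = lp_norm r (\<pi> s) g / mass (\<pi> 1) powr (1 / r)" if "1 \<le> s" for s
      using mass_pos[OF that] mass_pos[of 1] pos[OF that]
      by (simp add: lp_norm_normalized powr_divide)
    have "lp_norm r (normalized (\<pi> t)) g * (mass (\<pi> t) / mass (\<pi> 1)) powr (1 / r)
        \<le> lp_norm r (normalized (\<pi> (Suc t))) g * (mass (\<pi> (Suc t)) / mass (\<pi> 1)) powr (1 / r)"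
      using scale[of t] scale[of "Suc t"] gt(2) Suc.hyps by (simp add: divide_right_mono)
    \<comment> \<open>The one-step bound replaces the norm; the exponent may grow from
      \<open>1 / r\<close> to \<open>1 / q\<close> because the mass ratio is at least 1.\<close>
    also have "\<dots> \<le> lp_norm q (normalized (\<pi> (Suc t))) f * (mass (\<pi> (Suc t)) / mass (\<pi> 1)) powr (1 / q)"
    proof (intro mult_mono g(2) powr_mono)
      show "1 / r \<le> 1 / q" using qr Suc.prems(1) by (simp add: frac_le)
      show "1 \<le> mass (\<pi> (Suc t)) / mass (\<pi> 1)"
        using mass_mono_1[of "Suc t"] mass_pos[of 1] by simp
    qed (auto simp: lp_norm_def)
    finally show ?case using IH by (simp add: g_def)
  qed
qed

end
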